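(* Let $\alpha,\lambda\in\mathbb{R}$ with $\alpha\lambda\neq0$, and let $\mathcal{I}:T^*\mathbb{R}^5\to\mathfrak{sl}(2,\mathbb{R})$ and $\mathcal{J}:T^*\mathbb{R}^5\to\mathfrak{so}(5)$ be the momentum maps defined in the context. Then: (i) $\mathcal{I}$ and $\mathcal{J}$ are Poisson maps, i.e. the arrows in the diagram $\mathfrak{sl}(2,\mathbb{R})\xleftarrow{\ \mathcal{I}\ }T^*\mathbb{R}^5\xrightarrow{\ \mathcal{J}\ }\mathfrak{so}(5)$ are morphisms of Poisson manifolds, where $T^*\mathbb{R}^5$ carries its canonical Poisson bracket $\{\cdot,\cdot\}$, $\mathfrak{sl}(2,\mathbb{R})$ carries the Lie--Poisson bracket $\{\cdot,\cdot\}_{\mathfrak{sl}(2,\mathbb{R})}$, and $\mathfrak{so}(5)$ carries the Lie--Poisson bracket $\{\cdot,\cdot\}_{\lambda,\alpha}$. (ii) The fibers $\mathcal{I}^{-1}(\vec d)$ and $\mathcal{J}^{-1}(\rho)$ over $\vec d=(d_1,d_2,d_3)^\top\in\mathfrak{sl}(2,\mathbb{R})$ and $\rho\in\mathfrak{so}(5)$ are symplectically orthogonal, i.e. $$\{\mathcal{I}^*(C^\infty(\mathfrak{sl}(2,\mathbb{R}))),\ \mathcal{J}^*(C^\infty(\mathfrak{so}(5)))\}=0,$$ that is, $\{F\circ\mathcal{I},\,G\circ\mathcal{J}\}=0$ for all $F\in C^\infty(\mathfrak{sl}(2,\mathbb{R}))$ and $G\in C^\infty(\mathfrak{so}(5)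)$.
   Context: Elements of $T^*\mathbb{R}^5\cong\mathbb{R}^5\times\mathbb{R}^{5*}$ are $(q,p)$ with $q=(q_{-1},q_0,\vec q)$, $p=(p_{-1},p_0,\vec p)$, $\vec q,\vec p\in\mathbb{R}^3$. The canonical Poisson bracket is $\{f,g\}=\sum_k\big(\tfrac{\partial f}{\partial q_k}\tfrac{\partial g}{\partial p_k}-\tfrac{\partial f}{\partial p_k}\tfrac{\partial g}{\partial q_k}\big)$. Let $\eta_{\lambda,\alpha}=\mathrm{diag}(\alpha\lambda,\lambda,1,1,1)$. The map $\mathcal{J}$ into the antisymmetric $5\times5$ matrices $\mathfrak{so}(5)$ is $\mathcal{J}(q,p)=q(\eta_{\lambda,\alpha}^{-1}p)^\top-(\eta_{\lambda,\alpha}^{-1}p)q^\top$. Linear coordinates $(a,\vec x,\vec y,\vec\mu)\in\mathbb{R}\times\mathbb{R}^3\times\mathbb{R}^3\times\mathbb{R}^3$ of $\varrho\in\mathfrak{so}(5)$ are defined by $\varrho=\eta_{\lambda,\alpha}^{-1}\kappa-(\eta_{\lambda,\alpha}^{-1}\kappa)^\top$, where $\kappa$ is the strictly upper triangular matrix with first row $(0,a,x_1,x_2,x_3)$, second row $(0,0,y_1,y_2,y_3)$, third row $(0,0,0,\mu_3,-\mu_2)$, fourth row $(0,0,0,0,\mu_1)$ and zero fifth row. In these coordinates $\mathcal{J}$ reads $$a=\alpha q_{-1}p_0-q_0p_{-1},\quad\vec x=\alpha\lambda q_{-1}\vec p-p_{-1}\vec q,\quad\vec y=\lambda q_0\vec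 p-p_0\vec q,\quad\vec\mu=\vec q\times\vec p.$$ The Lie--Poisson bracket on $\mathfrak{so}(5)$, regarded as the dual of the Lie algebra of $SO_{\lambda,\alpha}(5)=\{g:g^\top\eta_{\lambda,\alpha}g=\eta_{\lambda,\alpha}\}$ through the pairing $(\varrho,Y)\mapsto\tfrac12\mathrm{Tr}(\eta_{\lambda,\alpha}Y\varrho)$, is $$\{f,g\}_{\lambda,\alpha}=\lambda a\Big(\tfrac{\partial f}{\partial\vec{x}}\cdot\tfrac{\partial g}{\partial\vec{y}}-\tfrac{\partial f}{\partial\vec{y}}\cdot\tfrac{\partial g}{\partial\vec{x}}\Big)+\vec{\mu}\cdot\Big(\alpha\lambda\,\tfrac{\partial f}{\partial\vec{x}}\times\tfrac{\partial g}{\partial\vec{x}}+\lambda\,\tfrac{\partial f}{\partial\vec{y}}\times\tfrac{\partial g}{\partial\vec{y}}+\tfrac{\partial f}{\partial\vec{\mu}}\times\tfrac{\partial g}{\partial\vec{\mu}}\Big)$$ $$+\tfrac{\partial g}{\partial a}\,\vec{x}\cdot\tfrac{\partial f}{\partial\vec{y}}-\tfrac{\partial f}{\partial a}\,\vec{x}\cdot\tfrac{\partial g}{\partial\vec{y}}-\alpha\tfrac{\partial g}{\partial a}\,\vec{y}\cdot\tfrac{\partial f}{\partial\vec{x}}+\alpha\tfrac{\partial f}{\partial a}\,\vec{y}\cdot\tfrac{\partial g}{\partial\vec{x}}$$ $$+\vec{x}\cdot\Big(\tfrac{\partial f}{\partial\vec{x}}\times\tfrac{\partial g}{\partial\vec{\mu}}+\tfrac{\partial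 f}{\partial\vec{\mu}}\times\tfrac{\partial g}{\partial\vec{x}}\Big)+\vec{y}\cdot\Big(\tfrac{\partial f}{\partial\vec{y}}\times\tfrac{\partial g}{\partial\vec{\mu}}+\tfrac{\partial f}{\partial\vec{\mu}}\times\tfrac{\partial g}{\partial\vec{y}}\Big).$$ The map $\mathcal{I}$ is $\mathcal{I}(q,p)=\begin{pmatrix}d_3&-d_1\\d_2&-d_3\end{pmatrix}$ with $$d_1=\alpha\lambda q_{-1}^2+\lambda q_0^2+\vec q^{\,2},\quad d_2=\tfrac1{\alpha\lambda}\big(p_{-1}^2+\alpha p_0^2+\alpha\lambda\vec p^{\,2}\big),\quad d_3=q_{-1}p_{-1}+q_0p_0+\vec q\cdot\vec p,$$ and $(d_1,d_2,d_3)$ are used as coordinates on $\mathfrak{sl}(2,\mathbb{R})$, which is identified with its dual by means of the trace. The Lie--Poisson bracket on $\mathfrak{sl}(2,\mathbb{R})$ is $$\{f,g\}_{\mathfrak{sl}(2,\mathbb{R})}=2d_3\Big(\tfrac{\partial f}{\partial d_1}\tfrac{\partial g}{\partial d_2}-\tfrac{\partial f}{\partial d_2}\tfrac{\partial g}{\partial d_1}\Big)+d_1\Big(\tfrac{\partial f}{\partial d_1}\tfrac{\partial g}{\partial d_3}-\tfrac{\partial f}{\partial d_3}\tfrac{\partial g}{\partial d_1}\Big)+d_2\Big(\tfrac{\partial f}{\partial d_3}\tfrac{\partial g}{\partial d_2}-\tfrac{\partial f}{\partial d_2}\tfrac{\partial g}{\partial d_3}\Big).$$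
   Formalization: The map I is shown to be Poisson for twice the printed Lie–Poisson bracket on sl(2,R); with the printed bracket the claim fails for all α, λ, since canonically {d1,d2}=4d3, {d1,d3}=2d1, {d3,d2}=2d2. J and (ii) are as stated. *)

theory Defs
  imports "HOL-Analysis.Analysis"
begin

text \<open>
  Points of \<open>T\<^sup>*\<real>\<^sup>5\<close> are pairs \<open>(q, p)\<close> of vectors in \<open>\<real>\<^sup>5\<close>, with \<open>q\<^sub>-\<^sub>1 = q $ 1\<close>, \<open>q\<^sub>0 = q $ 2\<close> and
  the 3-vector part \<open>(q $ 3, q $ 4, q $ 5)\<close>; likewise for \<open>p\<close>.  The real parameters \<open>\<lambda>\<close> and \<open>\<alpha>\<close>
  are written \<open>lam\<close> and \<open>\<alpha>\<close>.
\<close>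

definition vec3 :: "real^5 \<Rightarrow> real^3" where
  "vec3 q = vector [q $ 3, q $ 4, q $ 5]"


section \<open>Smooth functions and the canonical bracket\<close>

text \<open>On a finite-dimensional space, \<open>f\<close> is \<open>C\<^sup>k\<^sup>+\<^sup>1\<close> iff it is differentiable and all its directional
  derivatives are \<open>C\<^sup>k\<close>.\<close>

primrec Ck :: "nat \<Rightarrow> ('a::real_normed_vector \<Rightarrow> 'b::real_normed_vector) \<Rightarrow> bool" where
  "Ck 0 f \<longleftrightarrow> continuous_on UNIV f"
| "Ck (Suc k) f \<longleftrightarrow> (\<forall>x. f differentiable (at x)) \<and> (\<forall>v. Ck k (\<lambda>x. frechet_derivative f (at x) v))"

definition smooth :: "('a::real_normed_vector \<Rightarrow> 'b::real_normed_vector) \<Rightarrow> bool" where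
  "smooth f \<longleftrightarrow> (\<forall>k. Ck k f)"

definition partial :: "('a::real_normed_vector \<Rightarrow> real) \<Rightarrow> 'a \<Rightarrow> 'a \<Rightarrow> real" where
  "partial f v x = deriv (\<lambda>t. f (x + t *\<^sub>R v)) 0"

definition canonical_bracket ::
  "((real^5) \<times> (real^5) \<Rightarrow> real) \<Rightarrow> ((real^5) \<times> (real^5) \<Rightarrow> real) \<Rightarrow> (real^5) \<times> (real^5) \<Rightarrow> real" where
  "canonical_bracket f g z =
    (\<Sum>k\<in>UNIV. partial f (axis k 1, 0) z * partial g (0, axis k 1) z
             - partial f (0, axis k 1) z * partial g (axis k 1, 0) z)"


section \<open>Poisson maps into linear spaces of matrices\<close>

text \<open>
  The two target spaces are linear subspaces \<open>S\<close> of a space of matrices, with linear coordinates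
  given by an injective linear map \<open>chart\<close> onto \<open>S\<close> (see \<open>bij_sl2_mat\<close> and \<open>bij_so5_mat\<close>
  below).  A function on \<open>S\<close> is represented by a function on all matrices, of which only the values
  on \<open>S\<close> matter.  \<open>B f g c\<close> is the bracket at the point with coordinates \<open>c\<close> of the functions which
  are \<open>f\<close> and \<open>g\<close> in coordinates.
\<close>

definition smooth_in :: "('c::real_normed_vector \<Rightarrow> 'm) \<Rightarrow> ('m \<Rightarrow> real) \<Rightarrow> bool" where
  "smooth_in chart F \<longleftrightarrow> smooth (F \<circ> chart)"

definition chart_bracket ::
  "('c \<Rightarrow> 'm) \<Rightarrow> (('c \<Rightarrow> real) \<Rightarrow> ('c \<Rightarrow> real) \<Rightarrow> 'c \<Rightarrow> real) \<Rightarrow> ('m \<Rightarrow> real) \<Rightarrow> ('m \<Rightarrow> real) \<Rightarrow> 'm \<Rightarrow> real"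
  where "chart_bracket chart B F G A = B (F \<circ> chart) (G \<circ> chart) (inv chart A)"

definition poisson_map ::
  "'m set \<Rightarrow> ('c::real_normed_vector \<Rightarrow> 'm) \<Rightarrow> (('m \<Rightarrow> real) \<Rightarrow> ('m \<Rightarrow> real) \<Rightarrow> 'm \<Rightarrow> real)
    \<Rightarrow> ((real^5) \<times> (real^5) \<Rightarrow> 'm) \<Rightarrow> bool" where
  "poisson_map S chart bracket \<phi> \<longleftrightarrow>
     range \<phi> \<subseteq> S \<and>
     smooth (inv chart \<circ> \<phi>) \<and>
     (\<forall>F G. smooth_in chart F \<longrightarrow> smooth_in chart G \<longrightarrow>
        (\<forall>z. canonical_bracket (F \<circ> \<phi>) (G \<circ> \<phi>) z = bracket F G (\<phi> z)))"


section \<open>The Lie algebra \<open>sl(2)\<close> and the map \<open>I\<close>\<close>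

definition sl2 :: "(real^2^2) set" where
  "sl2 = {A. trace A = 0}"

definition sl2_mat :: "real^3 \<Rightarrow> real^2^2" where
  "sl2_mat d = vector [vector [d $ 3, - (d $ 1)], vector [d $ 2, - (d $ 3)]]"

lemma bij_sl2_mat: "bij_betw sl2_mat UNIV sl2"
proof (rule bij_betw_byWitness[where f' = "\<lambda>A. vector [- (A $ 1 $ 2), A $ 2 $ 1, A $ 1 $ 1]"])
  show "\<forall>d\<in>UNIV. vector [- (sl2_mat d $ 1 $ 2), sl2_mat d $ 2 $ 1, sl2_mat d $ 1 $ 1] = d"
    by (simp add: sl2_mat_def vec_eq_iff forall_3)
  show "\<forall>A\<in>sl2. sl2_mat (vector [- (A $ 1 $ 2), A $ 2 $ 1, A $ 1 $ 1]) = A"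
    by (auto simp: sl2_mat_def sl2_def trace_def sum_2 vec_eq_iff forall_2)
  show "sl2_mat ` UNIV \<subseteq> sl2"
    by (auto simp: sl2_mat_def sl2_def trace_def sum_2)
qed auto

definition sl2_bracket_coord :: "(real^3 \<Rightarrow> real) \<Rightarrow> (real^3 \<Rightarrow> real) \<Rightarrow> real^3 \<Rightarrow> real" where
  "sl2_bracket_coord f g d =
    (let f1 = partial f (axis 1 1) d; f2 = partial f (axis 2 1) d; f3 = partial f (axis 3 1) d;
         g1 = partial g (axis 1 1) d; g2 = partial g (axis 2 1) d; g3 = partial g (axis 3 1) d
     in 2 * d $ 3 * (f1 * g2 - f2 * g1) + d $ 1 * (f1 * g3 - f3 * g1) + d $ 2 * (f3 * g2 - f2 * g3))"

text \<open>
  This is the Lie--Poisson bracket for the identification of \<open>sl(2)\<close> with its dual by the pairing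
  \<open>Tr (X Y)\<close>.  Pitfall: the functions \<open>d\<^sub>1, d\<^sub>2, d\<^sub>3\<close> on \<open>T\<^sup>*\<real>\<^sup>5\<close> below have canonical brackets
  \<open>{d\<^sub>1, d\<^sub>2} = 4 d\<^sub>3\<close>, \<open>{d\<^sub>1, d\<^sub>3} = 2 d\<^sub>1\<close>, \<open>{d\<^sub>3, d\<^sub>2} = 2 d\<^sub>2\<close>, twice the values for \<open>sl2_bracket\<close>.
  The map \<open>mom_I\<close> is Poisson for \<open>2 * sl2_bracket\<close>, the Lie--Poisson bracket for the pairing
  \<open>Tr (X Y) / 2\<close> (the normalisation also used on \<open>so(5)\<close>), and not for \<open>sl2_bracket\<close>.
\<close>

definition sl2_bracket ::
  "(real^2^2 \<Rightarrow> real) \<Rightarrow> (real^2^2 \<Rightarrow> real) \<Rightarrow> real^2^2 \<Rightarrow> real" where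
  "sl2_bracket = chart_bracket sl2_mat sl2_bracket_coord"

fun mom_I :: "real \<Rightarrow> real \<Rightarrow> (real^5) \<times> (real^5) \<Rightarrow> real^2^2" where
  "mom_I lam \<alpha> (q, p) =
    (let d1 = \<alpha> * lam * (q $ 1)^2 + lam * (q $ 2)^2 + vec3 q \<bullet> vec3 q;
         d2 = 1 / (\<alpha> * lam) * ((p $ 1)^2 + \<alpha> * (p $ 2)^2 + \<alpha> * lam * (vec3 p \<bullet> vec3 p));
         d3 = q $ 1 * p $ 1 + q $ 2 * p $ 2 + vec3 q \<bullet> vec3 p
     in vector [vector [d3, - d1], vector [d2, - d3]])"


section \<open>The space \<open>so(5)\<close> and the map \<open>J\<close>\<close>

definition so5 :: "(real^5^5) set" where
  "so5 = {A. transpose A = - A}"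

definition eta :: "real \<Rightarrow> real \<Rightarrow> real^5^5" where
  "eta lam \<alpha> = (\<chi> i j. if i = j then (if i = 1 then \<alpha> * lam else if i = 2 then lam else 1) else 0)"

type_synonym so5_coords = "real \<times> (real^3) \<times> (real^3) \<times> (real^3)"

fun kappa :: "so5_coords \<Rightarrow> real^5^5" where
  "kappa (a, x, y, \<mu>) =
    vector [vector [0, a, x $ 1, x $ 2, x $ 3],
            vector [0, 0, y $ 1, y $ 2, y $ 3],
            vector [0, 0, 0, \<mu> $ 3, - (\<mu> $ 2)],
            vector [0, 0, 0, 0, \<mu> $ 1],
            vector [0, 0, 0, 0, 0]]"

definition so5_mat :: "real \<Rightarrow> real \<Rightarrow> so5_coords \<Rightarrow> real^5^5" where
  "so5_mat lam \<alpha> c = (let M = matrix_inv (eta lam \<alpha>) ** kappa c in M - transpose M)"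

definition grad3 :: "(so5_coords \<Rightarrow> real) \<Rightarrow> (real^3 \<Rightarrow> so5_coords) \<Rightarrow> so5_coords \<Rightarrow> real^3" where
  "grad3 f emb c = (\<chi> i. partial f (emb (axis i 1)) c)"

fun so5_bracket_coord ::
  "real \<Rightarrow> real \<Rightarrow> (so5_coords \<Rightarrow> real) \<Rightarrow> (so5_coords \<Rightarrow> real) \<Rightarrow> so5_coords \<Rightarrow> real" where
  "so5_bracket_coord lam \<alpha> f g (a, x, y, \<mu>) =
    (let c = (a, x, y, \<mu>);
         fa = partial f (1, 0, 0, 0) c; ga = partial g (1, 0, 0, 0) c;
         fx = grad3 f (\<lambda>v. (0, v, 0, 0)) c; gx = grad3 g (\<lambda>v. (0, v, 0, 0)) c;
         fy = grad3 f (\<lambda>v. (0, 0, v, 0)) c; gy = grad3 g (\<lambda>v. (0, 0, v, 0)) c;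
         fm = grad3 f (\<lambda>v. (0, 0, 0, v)) c; gm = grad3 g (\<lambda>v. (0, 0, 0, v)) c
     in lam * a * (fx \<bullet> gy - fy \<bullet> gx)
        + \<mu> \<bullet> ((\<alpha> * lam) *\<^sub>R cross3 fx gx + lam *\<^sub>R cross3 fy gy + cross3 fm gm)
        + ga * (x \<bullet> fy) - fa * (x \<bullet> gy) - \<alpha> * ga * (y \<bullet> fx) + \<alpha> * fa * (y \<bullet> gx)
        + x \<bullet> (cross3 fx gm + cross3 fm gx) + y \<bullet> (cross3 fy gm + cross3 fm gy))"

definition so5_bracket ::
  "real \<Rightarrow> real \<Rightarrow> (real^5^5 \<Rightarrow> real) \<Rightarrow> (real^5^5 \<Rightarrow> real) \<Rightarrow> real^5^5 \<Rightarrow> real" where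
  "so5_bracket lam \<alpha> = chart_bracket (so5_mat lam \<alpha>) (so5_bracket_coord lam \<alpha>)"

fun mom_J :: "real \<Rightarrow> real \<Rightarrow> (real^5) \<times> (real^5) \<Rightarrow> real^5^5" where
  "mom_J lam \<alpha> (q, p) =
    (let r = matrix_inv (eta lam \<alpha>) *v p in (\<chi> i j. q $ i * r $ j - r $ i * q $ j))"

lemma exhaust_5: "x = 1 \<or> x = 2 \<or> x = 3 \<or> x = 4 \<or> x = (5::5)"
proof (induct x)
  case (of_int z)
  then have "z = 0 \<or> z = 1 \<or> z = 2 \<or> z = 3 \<or> z = 4" by simp arith
  then show ?case by auto
qed

lemma forall_5: "(\<forall>i::5. P i) \<longleftrightarrow> P 1 \<and> P 2 \<and> P 3 \<and> P 4 \<and> P 5"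
  by (metis exhaust_5)

lemma sum_5: "sum f (UNIV::5 set) = f 1 + f 2 + f 3 + f 4 + f 5"
proof -
  have U: "UNIV = {1, 2, 3, 4, 5::5}" using exhaust_5 by auto
  show ?thesis unfolding U by (simp add: ac_simps)
qed

lemma vector_5:
  "(vector [a, b, c, d, e] :: 'a::zero^5) $ 1 = a"
  "(vector [a, b, c, d, e] :: 'a::zero^5) $ 2 = b"
  "(vector [a, b, c, d, e] :: 'a::zero^5) $ 3 = c"
  "(vector [a, b, c, d, e] :: 'a::zero^5) $ 4 = d"
  "(vector [a, b, c, d, e] :: 'a::zero^5) $ 5 = e"
  unfolding vector_def by simp_all

lemma matrix_inv_eta:
  assumes "\<alpha> * lam \<noteq> 0"
  shows "matrix_inv (eta lam \<alpha>) =
    (\<chi> i j. if i = j then (if i = 1 then 1 / (\<alpha> * lam) else if i = 2 then 1 / lam else 1) else 0)"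
    (is "_ = ?E")
proof -
  have E: "eta lam \<alpha> ** ?E = mat 1" "?E ** eta lam \<alpha> = mat 1"
    using assms by (auto simp: eta_def matrix_matrix_mult_def mat_def vec_eq_iff forall_5 sum_5)
  let ?N = "matrix_inv (eta lam \<alpha>)"
  have N: "eta lam \<alpha> ** ?N = mat 1 \<and> ?N ** eta lam \<alpha> = mat 1"
    unfolding matrix_inv_def by (rule someI[where x = ?E]) (rule conjI[OF E])
  have "?N = ?N ** (eta lam \<alpha> ** ?E)"
    unfolding E(1) matrix_mul_rid ..
  also have "\<dots> = ?E"
    unfolding matrix_mul_assoc conjunct2[OF N] matrix_mul_lid ..
  finally show ?thesis .
qed

lemma so5_mat_nth:
  assumes "\<alpha> * lam \<noteq> 0"
  shows "so5_mat lam \<alpha> (a, x, y, \<mu>) =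
    vector [vector [0, a / (\<alpha> * lam), x $ 1 / (\<alpha> * lam), x $ 2 / (\<alpha> * lam), x $ 3 / (\<alpha> * lam)],
            vector [- a / (\<alpha> * lam), 0, y $ 1 / lam, y $ 2 / lam, y $ 3 / lam],
            vector [- (x $ 1) / (\<alpha> * lam), - (y $ 1) / lam, 0, \<mu> $ 3, - (\<mu> $ 2)],
            vector [- (x $ 2) / (\<alpha> * lam), - (y $ 2) / lam, - (\<mu> $ 3), 0, \<mu> $ 1],
            vector [- (x $ 3) / (\<alpha> * lam), - (y $ 3) / lam, \<mu> $ 2, - (\<mu> $ 1), 0]]"
  unfolding so5_mat_def matrix_inv_eta[OF assms]
  by (simp add: Let_def matrix_matrix_mult_def transpose_def vec_eq_iff forall_5 sum_5 vector_5)

lemma bij_so5_mat: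
  assumes "\<alpha> * lam \<noteq> 0"
  shows "bij_betw (so5_mat lam \<alpha>) UNIV so5"
proof -
  define g :: "real^5^5 \<Rightarrow> so5_coords" where
    "g A = (\<alpha> * lam * A $ 1 $ 2,
            vector [\<alpha> * lam * A $ 1 $ 3, \<alpha> * lam * A $ 1 $ 4, \<alpha> * lam * A $ 1 $ 5],
            vector [lam * A $ 2 $ 3, lam * A $ 2 $ 4, lam * A $ 2 $ 5],
            vector [A $ 4 $ 5, - (A $ 3 $ 5), A $ 3 $ 4])" for A
  have nz: "\<alpha> \<noteq> 0" "lam \<noteq> 0" using assms by auto
  have "g (so5_mat lam \<alpha> c) = c" for c
  proof (cases c)
    case (fields a x y \<mu>)
    show ?thesis
      unfolding fields g_def so5_mat_nth[OF assms]
      by (simp add: vector_5 vec_eq_iff forall_3 nz)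
  qed
  moreover have "so5_mat lam \<alpha> (g A) = A" if "A \<in> so5" for A
  proof -
    have anti: "A $ j $ i = - (A $ i $ j)" for i j
    proof -
      have "transpose A = - A"
        using that unfolding so5_def by (rule CollectD)
      then have "transpose A $ i $ j = (- A) $ i $ j"
        by (rule arg_cong)
      then show ?thesis
        unfolding transpose_def vec_lambda_beta vector_uminus_component .
    qed
    have diag: "A $ i $ i = 0" for i
      using anti[of i i] by linarith
    show ?thesis
      unfolding g_def so5_mat_nth[OF assms] vec_eq_iff forall_5 vector_5
      by (simp add: nz diag
          anti[of 1 2] anti[of 1 3] anti[of 1 4] anti[of 1 5] anti[of 2 3] anti[of 2 4] anti[of 2 5]
          anti[of 3 4] anti[of 3 5] anti[of 4 5])
  qed
  moreover have "so5_mat lam \<alpha> c \<in> so5" for c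
    by (simp add: so5_mat_def so5_def Let_def transpose_def vec_eq_iff)
  ultimately show ?thesis
    by (intro bij_betw_byWitness[where f' = g]) auto
qed

end

theory Submission
  imports Defs
begin

text \<open>
  In coordinates both momentum maps are quadratic, \<open>z \<mapsto> B z z\<close> for a bilinear \<open>B\<close>.  Such a map is
  smooth with derivative \<open>v \<mapsto> B z v + B v z\<close>, so by the chain rule the partial derivatives of
  \<open>f \<circ> (\<lambda>z. B z z)\<close> are linear combinations of those of \<open>f\<close>, and each of the three bracket identities
  becomes a polynomial identity in \<open>q\<close>, \<open>p\<close> and the partial derivatives of the two functions.
\<close>

section \<open>Smoothness and partial derivatives\<close>

lemma Ck_const: "Ck k (\<lambda>x. c)"
  by (induction k arbitrary: c) (auto simp: frechet_derivative_const)

text \<open>The derivative of \<open>L\<close> is \<open>L\<close> at every point, so each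
  directional derivative is a constant function and \<open>Ck_const\<close> finishes.\<close>

lemma Ck_bounded_linear:
  assumes "bounded_linear L"
  shows "Ck k L"
proof (cases k)
  case 0
  then show ?thesis
    using assms by (simp add: linear_continuous_on)
next
  case (Suc n)
  have D: "(L has_derivative L) (at x)" for x
    using assms by (rule bounded_linear_imp_has_derivative)
  then show ?thesis
    unfolding Suc by (auto simp: differentiable_def Ck_const frechet_derivative_at[OF D, symmetric])
qed

lemma has_derivative_quadratic:
  fixes B :: "'a::euclidean_space \<Rightarrow> 'a \<Rightarrow> 'b::euclidean_space"
  assumes "bilinear B"
  shows "((\<lambda>z. B z z) has_derivative (\<lambda>v. B z v + B v z)) (at z)"
  using bounded_bilinear.FDERIV[OF _ has_derivative_ident has_derivative_ident, of B z UNIV] assms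
  by (simp add: bilinear_conv_bounded_bilinear)

text \<open>In a fixed direction \<open>v\<close> the derivative is linear in \<open>z\<close>, so a
  single differentiation leads to \<open>Ck_bounded_linear\<close>, without induction on the
  order.\<close>

lemma smooth_quadratic:
  fixes B :: "'a::euclidean_space \<Rightarrow> 'a \<Rightarrow> 'b::euclidean_space"
  assumes "bilinear B"
  shows "smooth (\<lambda>z. B z z)"
  unfolding smooth_def
proof
  fix k
  note D = has_derivative_quadratic[OF assms]
  show "Ck k (\<lambda>z. B z z)"
  proof (cases k)
    case 0
    then show ?thesis
      by (auto intro: has_derivative_continuous_on D)
  next
    case (Suc n)
    have "bounded_linear (\<lambda>z. B z v + B v z)" for v
      using assms unfolding bilinear_def
      by (intro bounded_linear_add) (auto simp: linear_conv_bounded_linear[symmetric])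
    then have "Ck n (\<lambda>z. B z v + B v z)" for v
      by (rule Ck_bounded_linear)
    then show ?thesis
      unfolding Suc using D by (auto simp: differentiable_def frechet_derivative_at[OF D, symmetric])
  qed
qed

text \<open>\<open>partial\<close> is a one-variable \<open>deriv\<close> along a line. Identifying
  it with the Frechet derivative gives access to linearity in \<open>v\<close> and to the chain
  rule.\<close>

lemma partial_eq:
  assumes "(f has_derivative f') (at x)"
  shows "partial f v x = f' v"
proof -
  have "((\<lambda>t. x + t *\<^sub>R v) has_derivative (\<lambda>t. t *\<^sub>R v)) (at 0)"
    by (auto intro!: derivative_eq_intros)
  then have "((\<lambda>t. f (x + t *\<^sub>R v)) has_derivative (\<lambda>t. f' (t *\<^sub>R v))) (at 0)"
    by (rule has_derivative_compose) (use assms in simp)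
  moreover have "f' (t *\<^sub>R v) = f' v * t" for t
    using has_derivative_linear[OF assms] by (simp add: linear_scale)
  ultimately have "((\<lambda>t. f (x + t *\<^sub>R v)) has_field_derivative f' v) (at 0)"
    by (simp add: has_field_derivative_def)
  then show ?thesis
    unfolding partial_def by (rule DERIV_imp_deriv)
qed

lemma smooth_partial:
  assumes "smooth f"
  obtains f' where "linear f'" "\<And>v. partial f v x = f' v" "(f has_derivative f') (at x)"
proof -
  have "Ck (Suc 0) f"
    using assms unfolding smooth_def ..
  then obtain f' where "(f has_derivative f') (at x)"
    by (auto simp: differentiable_def)
  then show ?thesis
    using that[of f'] by (simp add: partial_eq has_derivative_linear)
qed

lemma smooth_linear_partial: "smooth f \<Longrightarrow> linear (\<lambda>v. partial f v x)"
  by (metis (no_types, lifting) ext smooth_partial)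

lemma partial_comp_quadratic:
  fixes B :: "'a::euclidean_space \<Rightarrow> 'a \<Rightarrow> 'b::euclidean_space"
  assumes "smooth f" "bilinear B"
  shows "partial (f \<circ> (\<lambda>z. B z z)) v z = partial f (B z v + B v z) (B z z)"
proof -
  obtain f' where f': "\<And>v. partial f v (B z z) = f' v" "(f has_derivative f') (at (B z z))"
    using smooth_partial[OF assms(1)] by blast
  show ?thesis
    using partial_eq[OF diff_chain_at[OF has_derivative_quadratic[OF assms(2)] f'(2)]]
    by (simp add: f'(1))
qed

lemma linear_3:
  fixes h :: "real^3 \<Rightarrow> real"
  assumes "linear h"
  shows "h v = v $ 1 * h (axis 1 1) + v $ 2 * h (axis 2 1) + v $ 3 * h (axis 3 1)"
proof -
  have "v = v $ 1 *\<^sub>R axis 1 1 + v $ 2 *\<^sub>R axis 2 1 + v $ 3 *\<^sub>R axis 3 1"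
    by (simp add: vec_eq_iff forall_3 axis_def)
  then have "h v = h (v $ 1 *\<^sub>R axis 1 1 + v $ 2 *\<^sub>R axis 2 1 + v $ 3 *\<^sub>R axis 3 1)"
    by (rule arg_cong)
  then show ?thesis
    using assms by (simp add: linear_add linear_scale)
qed

text \<open>The directions on the right are those in which \<open>so5_bracket_coord\<close>
  differentiates.\<close>

lemma linear_so5_coords:
  fixes h :: "so5_coords \<Rightarrow> real"
  assumes "linear h"
  shows "h (a, x, y, \<mu>) = a * h (1, 0, 0, 0)
    + (x $ 1 * h (0, axis 1 1, 0, 0) + x $ 2 * h (0, axis 2 1, 0, 0) + x $ 3 * h (0, axis 3 1, 0, 0))
    + (y $ 1 * h (0, 0, axis 1 1, 0) + y $ 2 * h (0, 0, axis 2 1, 0) + y $ 3 * h (0, 0, axis 3 1, 0))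
    + (\<mu> $ 1 * h (0, 0, 0, axis 1 1) + \<mu> $ 2 * h (0, 0, 0, axis 2 1) + \<mu> $ 3 * h (0, 0, 0, axis 3 1))"
proof -
  have lin: "linear (\<lambda>v. h (0, v, 0, 0))" "linear (\<lambda>v. h (0, 0, v, 0))" "linear (\<lambda>v. h (0, 0, 0, v))"
    by (rule linear_compose[OF _ assms, unfolded comp_def], simp add: linear_iff)+
  have "h (a, x, y, \<mu>) = h (a *\<^sub>R (1, 0, 0, 0) + (0, x, 0, 0) + (0, 0, y, 0) + (0, 0, 0, \<mu>))"
    by simp
  also have "\<dots> = a * h (1, 0, 0, 0) + h (0, x, 0, 0) + h (0, 0, y, 0) + h (0, 0, 0, \<mu>)"
    by (simp only: linear_add[OF assms] linear_scale[OF assms] real_scaleR_def)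
  finally show ?thesis
    by (simp only: linear_3[OF lin(1), of x] linear_3[OF lin(2), of y] linear_3[OF lin(3), of \<mu>])
qed

text \<open>Here \<open>\<psi>\<close> is \<open>\<phi>\<close> read in coordinates. As
  \<open>chart\<close> is injective, \<open>inv chart\<close> cancels and all conditions become
  statements about functions on the coordinate space.\<close>

lemma poisson_mapI:
  assumes bij: "bij_betw chart UNIV S"
    and chart: "\<And>z. chart (\<psi> z) = \<phi> z"
    and smooth: "smooth \<psi>"
    and bracket: "\<And>f g z. smooth f \<Longrightarrow> smooth g \<Longrightarrow> canonical_bracket (f \<circ> \<psi>) (g \<circ> \<psi>) z = B f g (\<psi> z)"
  shows "poisson_map S chart (chart_bracket chart B) \<phi>"
proof -
  have \<phi>: "\<phi> = chart \<circ> \<psi>"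
    using chart by auto
  have "inv chart \<circ> \<phi> = \<psi>"
    using bij by (auto simp: \<phi> bij_betw_def)
  then show ?thesis
    unfolding poisson_map_def using bij smooth bracket
    by (auto simp: bij_betw_def chart_bracket_def smooth_in_def \<phi> simp flip: comp_assoc)
qed

section \<open>The momentum maps as quadratic maps\<close>

lemma vec3_nth [simp]: "vec3 q $ 1 = q $ 3" "vec3 q $ 2 = q $ 4" "vec3 q $ 3 = q $ 5"
  by (simp_all add: vec3_def)

lemma inner_3: "x \<bullet> y = x $ 1 * y $ 1 + x $ 2 * y $ 2 + x $ 3 * y $ 3" for x y :: "real^3"
  by (simp add: inner_vec_def sum_3)

text \<open>Only the diagonal matters: it yields \<open>d1\<close>, \<open>d2\<close>,
  \<open>d3\<close> of \<open>mom_I\<close>. The last entry is left asymmetric, since the derivative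
  \<open>B z v + B v z\<close> symmetrises it.\<close>

fun polar_I :: "real \<Rightarrow> real \<Rightarrow> (real^5) \<times> (real^5) \<Rightarrow> (real^5) \<times> (real^5) \<Rightarrow> real^3" where
  "polar_I lam \<alpha> (q, p) (q', p') = vector
    [\<alpha> * lam * q $ 1 * q' $ 1 + lam * q $ 2 * q' $ 2 + vec3 q \<bullet> vec3 q',
     1 / (\<alpha> * lam) * (p $ 1 * p' $ 1 + \<alpha> * p $ 2 * p' $ 2 + \<alpha> * lam * (vec3 p \<bullet> vec3 p')),
     q $ 1 * p' $ 1 + q $ 2 * p' $ 2 + vec3 q \<bullet> vec3 p']"

text \<open>The diagonal yields the coordinates of \<open>mom_J\<close>, in which the denominators
  coming from the inverse of \<open>eta\<close> have been cleared.\<close>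

fun polar_J :: "real \<Rightarrow> real \<Rightarrow> (real^5) \<times> (real^5) \<Rightarrow> (real^5) \<times> (real^5) \<Rightarrow> so5_coords" where
  "polar_J lam \<alpha> (q, p) (q', p') =
    (\<alpha> * q $ 1 * p' $ 2 - q $ 2 * p' $ 1,
     (\<alpha> * lam * q $ 1) *\<^sub>R vec3 p' - p' $ 1 *\<^sub>R vec3 q,
     (lam * q $ 2) *\<^sub>R vec3 p' - p' $ 2 *\<^sub>R vec3 q,
     cross3 (vec3 q) (vec3 p'))"

lemma bilinear_polar_I: "bilinear (polar_I lam \<alpha>)"
  unfolding bilinear_def linear_iff split_paired_All
  by (simp add: vec_eq_iff forall_3 inner_3 algebra_simps add_divide_distrib)

lemma bilinear_polar_J: "bilinear (polar_J lam \<alpha>)"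
  unfolding bilinear_def linear_iff split_paired_All
  by (simp add: vec_eq_iff forall_3 cross3_def algebra_simps)

lemma sl2_mat_polar_I: "sl2_mat (polar_I lam \<alpha> z z) = mom_I lam \<alpha> z"
  by (cases z) (simp add: sl2_mat_def Let_def power2_eq_square algebra_simps)

lemma so5_mat_polar_J:
  assumes "\<alpha> * lam \<noteq> 0"
  shows "so5_mat lam \<alpha> (polar_J lam \<alpha> z z) = mom_J lam \<alpha> z"
proof (cases z)
  case (Pair q p)
  have nz: "\<alpha> \<noteq> 0" "lam \<noteq> 0"
    using assms by auto
  show ?thesis
    unfolding Pair polar_J.simps so5_mat_nth[OF assms] mom_J.simps matrix_inv_eta[OF assms] Let_def
      vec_eq_iff forall_5 vector_5 cross3_def
    by (simp add: matrix_vector_mult_def sum_5) (simp add: nz diff_divide_distrib)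
qed

section \<open>The bracket identities\<close>

lemma partial_comp_polar_I:
  assumes "smooth f"
  shows "partial (f \<circ> (\<lambda>z. polar_I lam \<alpha> z z)) v z =
    (let c = polar_I lam \<alpha> z z; w = polar_I lam \<alpha> z v + polar_I lam \<alpha> v z
     in w $ 1 * partial f (axis 1 1) c + w $ 2 * partial f (axis 2 1) c + w $ 3 * partial f (axis 3 1) c)"
  unfolding partial_comp_quadratic[OF assms bilinear_polar_I] Let_def
  by (rule linear_3[OF smooth_linear_partial[OF assms]])

lemma partial_comp_polar_J:
  assumes "smooth f"
  shows "partial (f \<circ> (\<lambda>z. polar_J lam \<alpha> z z)) v z =
    (let c = polar_J lam \<alpha> z z
     in case polar_J lam \<alpha> z v + polar_J lam \<alpha> v z of (a, x, y, \<mu>) \<Rightarrow>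
       a * partial f (1, 0, 0, 0) c + x \<bullet> grad3 f (\<lambda>v. (0, v, 0, 0)) c
       + y \<bullet> grad3 f (\<lambda>v. (0, 0, v, 0)) c + \<mu> \<bullet> grad3 f (\<lambda>v. (0, 0, 0, v)) c)"
proof -
  obtain a x y \<mu> where w: "polar_J lam \<alpha> z v + polar_J lam \<alpha> v z = (a, x, y, \<mu>)"
    by (rule prod_cases4)
  show ?thesis
    unfolding partial_comp_quadratic[OF assms bilinear_polar_J] Let_def w
      linear_so5_coords[OF smooth_linear_partial[OF assms], of a x y \<mu>]
    by (simp add: inner_3 grad3_def)
qed

text \<open>By the chain rule both sides are bilinear in the partial derivatives of \<open>f\<close>
  and \<open>g\<close>, so the brackets of the coordinates decide. The factor 2 is that in {d1, d2}
  = 4 d3, {d1, d3} = 2 d1 and {d3, d2} = 2 d2.\<close>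

lemma canonical_bracket_polar_I:
  assumes "\<alpha> * lam \<noteq> 0" "smooth f" "smooth g"
  shows "canonical_bracket (f \<circ> (\<lambda>z. polar_I lam \<alpha> z z)) (g \<circ> (\<lambda>z. polar_I lam \<alpha> z z)) z
    = 2 * sl2_bracket_coord f g (polar_I lam \<alpha> z z)"
proof (cases z)
  case (Pair q p)
  have nz: "\<alpha> \<noteq> 0" "lam \<noteq> 0"
    using assms by auto
  \<comment> \<open>Folding the base point into \<open>c\<close> keeps the arguments of the partial
    derivatives opaque while \<open>polar_I\<close> is evaluated on axis vectors.\<close>
  define c where "c = polar_I lam \<alpha> (q, p) (q, p)"
  show ?thesis
    unfolding Pair canonical_bracket_def sl2_bracket_coord_def sum_5
      assms(2,3)[THEN partial_comp_polar_I] Let_def c_def[symmetric]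
    by (simp add: inner_3 axis_def) (simp add: c_def inner_3 nz field_simps)
qed

text \<open>Again the brackets of the coordinates decide, for instance {x_i, a} = -\<alpha>
  y_i.\<close>

lemma canonical_bracket_polar_J:
  assumes "smooth f" "smooth g"
  shows "canonical_bracket (f \<circ> (\<lambda>z. polar_J lam \<alpha> z z)) (g \<circ> (\<lambda>z. polar_J lam \<alpha> z z)) z
    = so5_bracket_coord lam \<alpha> f g (polar_J lam \<alpha> z z)"
proof (cases z)
  case (Pair q p)
  show ?thesis
    unfolding Pair canonical_bracket_def sum_5 assms[THEN partial_comp_polar_J]
    by (simp add: Let_def inner_3 axis_def cross3_def) (simp add: algebra_simps)
qed

text \<open>Conceptually, the coordinates of \<open>mom_J\<close> generate the linear action
  preserving \<open>eta\<close>, and d1, d2, d3 are its invariants: the square of \<open>q\<close>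
  for \<open>eta\<close>, the square of \<open>p\<close> for the inverse of \<open>eta\<close>, and
  the pairing of \<open>q\<close> with \<open>p\<close>. The proof checks the cancellation
  directly.\<close>

lemma canonical_bracket_polar_I_polar_J:
  assumes "\<alpha> * lam \<noteq> 0" "smooth f" "smooth g"
  shows "canonical_bracket (f \<circ> (\<lambda>z. polar_I lam \<alpha> z z)) (g \<circ> (\<lambda>z. polar_J lam \<alpha> z z)) z = 0"
proof (cases z)
  case (Pair q p)
  have nz: "\<alpha> \<noteq> 0" "lam \<noteq> 0"
    using assms by auto
  show ?thesis
    unfolding Pair canonical_bracket_def sum_5
      partial_comp_polar_I[OF assms(2)] partial_comp_polar_J[OF assms(3)]
    by (simp add: Let_def inner_3 axis_def cross3_def) (simp add: nz field_simps)
qed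

theorem proposition3p1:
  fixes lam \<alpha> :: real
  assumes "\<alpha> * lam \<noteq> 0"
  shows "poisson_map sl2 sl2_mat (\<lambda>F G A. 2 * sl2_bracket F G A) (mom_I lam \<alpha>) \<and>
         poisson_map so5 (so5_mat lam \<alpha>) (so5_bracket lam \<alpha>) (mom_J lam \<alpha>) \<and>
         (\<forall>F G. smooth_in sl2_mat F \<longrightarrow> smooth_in (so5_mat lam \<alpha>) G \<longrightarrow>
            (\<forall>z. canonical_bracket (F \<circ> mom_I lam \<alpha>) (G \<circ> mom_J lam \<alpha>) z = 0))"
proof (intro conjI allI impI)
  have "poisson_map sl2 sl2_mat
      (chart_bracket sl2_mat (\<lambda>f g c. 2 * sl2_bracket_coord f g c)) (mom_I lam \<alpha>)"
    by (rule poisson_mapI[where \<psi> = "\<lambda>z. polar_I lam \<alpha> z z", OF bij_sl2_mat sl2_mat_polar_I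
          smooth_quadratic[OF bilinear_polar_I]])
      (rule canonical_bracket_polar_I[OF assms])
  \<comment> \<open>Moving the factor 2 into the coordinate bracket gives the form required by
    \<open>poisson_mapI\<close>.\<close>
  moreover have "(\<lambda>F G A. 2 * sl2_bracket F G A)
      = chart_bracket sl2_mat (\<lambda>f g c. 2 * sl2_bracket_coord f g c)"
    by (simp add: fun_eq_iff sl2_bracket_def chart_bracket_def)
  ultimately show "poisson_map sl2 sl2_mat (\<lambda>F G A. 2 * sl2_bracket F G A) (mom_I lam \<alpha>)"
    by simp
  show "poisson_map so5 (so5_mat lam \<alpha>) (so5_bracket lam \<alpha>) (mom_J lam \<alpha>)"
    unfolding so5_bracket_def
    by (rule poisson_mapI[where \<psi> = "\<lambda>z. polar_J lam \<alpha> z z", OF bij_so5_mat[OF assms]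
          so5_mat_polar_J[OF assms] smooth_quadratic[OF bilinear_polar_J]])
      (rule canonical_bracket_polar_J)
  fix F G z
  assume "smooth_in sl2_mat F" "smooth_in (so5_mat lam \<alpha>) G"
  \<comment> \<open>Both maps are factored through their charts, because smoothness is assumed only
    for \<open>F\<close> and \<open>G\<close> in coordinates.\<close>
  then have "canonical_bracket ((F \<circ> sl2_mat) \<circ> (\<lambda>z. polar_I lam \<alpha> z z))
      ((G \<circ> so5_mat lam \<alpha>) \<circ> (\<lambda>z. polar_J lam \<alpha> z z)) z = 0"
    unfolding smooth_in_def by (rule canonical_bracket_polar_I_polar_J[OF assms])
  then show "canonical_bracket (F \<circ> mom_I lam \<alpha>) (G \<circ> mom_J lam \<alpha>) z = 0"
    by (simp add: comp_def sl2_mat_polar_I so5_mat_polar_J[OF assms])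
qed

end
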